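(* Let $0<\alpha<\pi/2$, $\lambda_\alpha=4\sin^2\alpha$, and let $a\in\mathbb C$ with $\Re a>-\tfrac12$. With $f(x)=\frac{\Gamma(x)^2}{2\Gamma(2x)}$ and $\Phi_\alpha(a)=\sum_{k=1}^{\infty}\lambda_\alpha^{k+a-1}f(k+a)$, one has $$\Phi_\alpha(a)=\frac{1}{\sin(2\alpha)}\,\frac{\Gamma(1+a)^2}{\Gamma(1+2a)}\int_0^\alpha(2\sin\theta)^{2a}\,d\theta.$$
   Context: The function $f$ is considered for complex $x$ with $\Re x>0$. Complex powers of positive real numbers use the real logarithm of the base. The series defining $\Phi_\alpha(a)$ converges for all $a$ with $\Re a>-1$ and is holomorphic there. *)

theory Defs
  imports "HOL-Analysis.Analysis"
begin

definition f :: "complex \<Rightarrow> complex" where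
  "f x = Gamma x ^ 2 / (2 * Gamma (2 * x))"

definition lam :: "real \<Rightarrow> real" where
  "lam \<alpha> = 4 * sin \<alpha> ^ 2"

text \<open>
  The sum over \<open>k \<ge> 1\<close> is indexed by \<open>Suc k\<close>. On a positive real base, complex
  \<open>powr\<close> is taken with the principal branch of the logarithm, that is, with the real logarithm.
\<close>

definition Phi :: "real \<Rightarrow> complex \<Rightarrow> complex" where
  "Phi \<alpha> a =
     (\<Sum>k. complex_of_real (lam \<alpha>) powr (of_nat (Suc k) + a - 1) * f (of_nat (Suc k) + a))"

end

theory Submission
  imports Defs
begin

text \<open>
  Put \<open>S(z) = \<Sum>n. f(n + 1 + a) z\<^sup>n\<close>. The recurrence of \<open>Gamma\<close> gives
  \<open>2 (2x + 1) f(x + 1) = x f(x)\<close>, which for \<open>S\<close> is the first order equation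
  \<open>z (4 - z) S' + (2 + 4a - (1 + a) z) S = (2 + 4a) f(1 + a)\<close>.
  Under \<open>z = 4 sin\<^sup>2 \<theta>\<close> it says that \<open>sin(2\<theta>) z\<^sup>a S(z)\<close> has derivative
  \<open>(2 + 4a) f(1 + a) (2 sin \<theta>)\<^bsup>2a\<^esup>\<close>. This primitive is continuous up to \<open>\<theta> = 0\<close> and vanishes
  there, being bounded by \<open>z powr (Re a + 1/2) * norm (S z)\<close>.
\<close>

section \<open>The coefficients and their power series\<close>

lemma Re_pos_notin_nonpos_Ints: "Re x > 0 \<Longrightarrow> x \<notin> \<int>\<^sub>\<le>\<^sub>0"
  by (auto elim!: nonpos_Ints_cases)

lemma f_plus1:
  assumes "Re x > 0"
  shows "2 * (2 * x + 1) * f (x + 1) = x * f x"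
proof -
  have nz: "x \<noteq> 0" "2 * x + 1 \<noteq> 0"
    using assms by (auto simp: complex_eq_iff)
  have ni: "x \<notin> \<int>\<^sub>\<le>\<^sub>0" "2 * x \<notin> \<int>\<^sub>\<le>\<^sub>0" "2 * x + 1 \<notin> \<int>\<^sub>\<le>\<^sub>0"
    using assms by (auto intro!: Re_pos_notin_nonpos_Ints)
  have G1: "Gamma (x + 1) = x * Gamma x"
    using ni by (intro Gamma_plus1)
  have "Gamma (2 * x + 1 + 1) = (2 * x + 1) * Gamma (2 * x + 1)"
    using ni by (intro Gamma_plus1)
  also have "Gamma (2 * x + 1) = 2 * x * Gamma (2 * x)"
    using ni by (intro Gamma_plus1)
  finally have G2: "Gamma (2 * (x + 1)) = (2 * x + 1) * (2 * x * Gamma (2 * x))"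
    by (simp add: algebra_simps)
  have "Gamma (2 * x) \<noteq> 0"
    using ni by (simp add: Gamma_eq_zero_iff)
  with nz show ?thesis
    unfolding f_def G1 G2 by (simp add: divide_simps) (simp add: power2_eq_square)
qed

definition fser :: "complex \<Rightarrow> complex \<Rightarrow> complex" where
  "fser a z = (\<Sum>n. f (of_nat (Suc n) + a) * z ^ n)"

text \<open>The termwise derivative of \<open>fser a\<close>, kept as a series so that the
  differential equation can be checked coefficient by coefficient.\<close>

definition fser' :: "complex \<Rightarrow> complex \<Rightarrow> complex" where
  "fser' a z = (\<Sum>n. diffs (\<lambda>n. f (of_nat (Suc n) + a)) n * z ^ n)"

lemma f_coeff_rec:
  assumes "Re a > - 1 / 2"
  shows "2 * (2 * of_nat n + 3 + 2 * a) * f (of_nat (Suc (Suc n)) + a)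
           = (of_nat (Suc n) + a) * f (of_nat (Suc n) + a)"
proof -
  have "Re (of_nat (Suc n) + a) > 0"
    using assms by simp
  from f_plus1[OF this] show ?thesis
    by (simp add: algebra_simps)
qed

text \<open>By the recurrence, consecutive coefficients have ratio
  \<open>(n + 1 + a) / (4 * (n + 3 / 2 + a))\<close>, of norm at most 1/4 for every
  \<open>n\<close>. Hence the ratio test applies with constant \<open>norm z / 4\<close>.\<close>

lemma summable_fser:
  assumes a: "Re a > - 1 / 2" and z: "norm z < 4"
  shows "summable (\<lambda>n. f (of_nat (Suc n) + a) * z ^ n)"
proof (rule summable_ratio_test)
  show "norm z / 4 < 1"
    using z by simp
  fix n :: nat
  define c where "c = (\<lambda>n. f (of_nat (Suc n) + a))"
  define d :: complex where "d = of_nat n + 3 / 2 + a"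
  \<comment> \<open>Both numbers have imaginary part \<open>Im a\<close> and positive real part, so
    comparing real parts compares norms.\<close>
  have "(Re (of_nat (Suc n) + a))\<^sup>2 \<le> (Re d)\<^sup>2"
    using a by (intro power_mono) (auto simp: d_def)
  hence "norm (of_nat (Suc n) + a) \<le> norm d"
    by (simp add: cmod_def d_def)
  moreover have "Re d > 0"
    using a by (simp add: d_def)
  hence d: "norm d > 0"
    by auto
  have "4 * d * c (Suc n) = (of_nat (Suc n) + a) * c n"
    using f_coeff_rec[OF a, of n] by (simp add: c_def d_def algebra_simps)
  hence "4 * norm d * norm (c (Suc n)) = norm (of_nat (Suc n) + a) * norm (c n)"
    by (metis norm_mult norm_numeral)
  ultimately have "norm d * (4 * norm (c (Suc n))) \<le> norm d * norm (c n)"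
    using mult_right_mono[of "norm (of_nat (Suc n) + a)" "norm d" "norm (c n)"] by (simp add: mult_ac)
  with d have "4 * norm (c (Suc n)) \<le> norm (c n)"
    by (simp add: mult_le_cancel_left)
  hence "norm z ^ Suc n * (4 * norm (c (Suc n))) \<le> norm z ^ Suc n * norm (c n)"
    by (intro mult_left_mono) auto
  thus "norm (f (of_nat (Suc (Suc n)) + a) * z ^ Suc n)
          \<le> norm z / 4 * norm (f (of_nat (Suc n) + a) * z ^ n)"
    unfolding c_def norm_mult norm_power by (simp add: field_simps)
qed

lemma has_field_derivative_fser:
  assumes "Re a > - 1 / 2" "norm z < 4"
  shows "(fser a has_field_derivative fser' a z) (at z)"
  using termdiffs_strong'[of 4 "\<lambda>n. f (of_nat (Suc n) + a)" z] summable_fser[OF assms(1)] assms(2)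
  unfolding fser_def[abs_def] fser'_def by blast

text \<open>With \<open>c n\<close> the coefficients of \<open>fser a\<close>, the equation is
  rearranged to \<open>4 z S' + (2 + 4 a) (S - c 0) = z (z S' + (1 + a) S)\<close>. Comparing the
  coefficients of \<open>z ^ Suc n\<close> on both sides gives exactly
  \<open>f_coeff_rec\<close>.\<close>

lemma fser_ode:
  assumes a: "Re a > - 1 / 2" and z: "norm z < 4"
  shows "z * (4 - z) * fser' a z + (2 + 4 * a - (1 + a) * z) * fser a z = (2 + 4 * a) * f (1 + a)"
proof -
  define c where "c = (\<lambda>n. f (of_nat (Suc n) + a))"
  have sums: "(\<lambda>n. c n * z ^ n) sums fser a z"
    using summable_fser[OF a z] by (simp add: c_def fser_def summable_sums)
  have "summable (\<lambda>n. diffs c n * z ^ n)"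
    using z summable_fser[OF a] by (intro termdiff_converges[of z 4]) (auto simp: c_def)
  hence sums': "(\<lambda>n. diffs c n * z ^ n) sums fser' a z"
    by (simp add: c_def fser'_def summable_sums)
  \<comment> \<open>The term \<open>c 0 = f (1 + a)\<close> split off here becomes the inhomogeneous
    term of the equation.\<close>
  have shift: "(\<lambda>n. c (Suc n) * z ^ Suc n) sums (fser a z - c 0)"
    using sums by (subst sums_Suc_iff) simp
  have D1: "(\<lambda>n. 4 * (z * (diffs c n * z ^ n)) + (2 + 4 * a) * (c (Suc n) * z ^ Suc n))
           sums (4 * (z * fser' a z) + (2 + 4 * a) * (fser a z - c 0))"
    by (intro sums_add sums_mult sums' shift)
  \<comment> \<open>The term at \<open>n = 0\<close> is zero, so shifting the index leaves the sum
    unchanged.\<close>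
  have "(\<lambda>n. of_nat n * c n * z ^ n) sums (z * fser' a z)"
    using sums_mult[OF sums', of z]
    by (subst sums_Suc_iff[symmetric, where f = "\<lambda>n. of_nat n * c n * z ^ n", simplified])
       (simp add: diffs_def mult_ac)
  hence D2: "(\<lambda>n. z * (of_nat n * c n * z ^ n) + (1 + a) * (z * (c n * z ^ n)))
           sums (z * (z * fser' a z) + (1 + a) * (z * fser a z))"
    by (intro sums_add sums_mult sums)
  have "4 * (z * (diffs c n * z ^ n)) + (2 + 4 * a) * (c (Suc n) * z ^ Suc n)
        = z * (of_nat n * c n * z ^ n) + (1 + a) * (z * (c n * z ^ n))" for n
  proof -
    have "4 * (z * (diffs c n * z ^ n)) + (2 + 4 * a) * (c (Suc n) * z ^ Suc n)
          = 2 * (2 * of_nat n + 3 + 2 * a) * c (Suc n) * z ^ Suc n"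
      by (simp add: diffs_def algebra_simps)
    also have "\<dots> = (of_nat (Suc n) + a) * c n * z ^ Suc n"
      unfolding c_def f_coeff_rec[OF a] ..
    finally show ?thesis
      by (simp add: algebra_simps)
  qed
  with D1 D2 have "4 * (z * fser' a z) + (2 + 4 * a) * (fser a z - c 0)
      = z * (z * fser' a z) + (1 + a) * (z * fser a z)"
    using sums_unique2 by simp
  thus ?thesis
    by (simp add: c_def algebra_simps)
qed

section \<open>The substitution z = 4 sin^2 \<theta>\<close>

lemma lam_bounds:
  assumes "0 < \<alpha>" "\<alpha> < pi / 2"
  shows "0 < lam \<alpha>" "lam \<alpha> < 4"
proof -
  have "0 < sin \<alpha>" "0 < cos \<alpha>"
    using assms by (auto intro!: sin_gt_zero cos_gt_zero)
  moreover from this have "0 < sin \<alpha> ^ 2"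
    by simp
  ultimately show "0 < lam \<alpha>" "lam \<alpha> < 4"
    using sin_cos_squared_add[of \<alpha>] zero_less_power[of "cos \<alpha>" 2]
    unfolding lam_def by linarith+
qed

text \<open>Squaring the base doubles the exponent because \<open>2 * sin \<alpha>\<close> is
  positive: all logarithms are real and no branch is crossed. This turns \<open>z powr a\<close>
  into the integrand of the theorem.\<close>

lemma lam_powr:
  assumes "0 < \<alpha>" "\<alpha> < pi / 2"
  shows "complex_of_real (lam \<alpha>) powr a = complex_of_real (2 * sin \<alpha>) powr (2 * a)"
proof -
  have s: "0 < sin \<alpha>"
    using assms by (auto intro!: sin_gt_zero)
  have "ln (lam \<alpha>) = ln ((2 * sin \<alpha>) ^ 2)"
    by (simp add: lam_def power_mult_distrib)
  also have "\<dots> = 2 * ln (2 * sin \<alpha>)"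
    using s by (subst ln_realpow) auto
  finally have "ln (lam \<alpha>) = 2 * ln (2 * sin \<alpha>)" .
  moreover have "lam \<alpha> > 0"
    using lam_bounds[OF assms] by simp
  ultimately show ?thesis
    using s unfolding powr_def by (simp add: Ln_of_real mult.assoc mult.left_commute del: of_real_mult)
      (simp add: mult_ac)
qed

lemma Phi_eq_fser:
  assumes \<alpha>: "0 < \<alpha>" "\<alpha> < pi / 2" and a: "Re a > - 1 / 2"
  shows "Phi \<alpha> a = complex_of_real (lam \<alpha>) powr a * fser a (of_real (lam \<alpha>))"
proof -
  define z where "z = complex_of_real (lam \<alpha>)"
  have z: "z \<noteq> 0" "norm z < 4"
    using lam_bounds[OF \<alpha>] by (auto simp: z_def)
  have "z powr (of_nat (Suc k) + a - 1) = z powr a * z ^ k" for k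
    using z by (simp add: powr_add powr_nat' mult_ac)
  hence "Phi \<alpha> a = (\<Sum>k. z powr a * (f (of_nat (Suc k) + a) * z ^ k))"
    unfolding Phi_def z_def by (simp add: mult_ac)
  also have "\<dots> = z powr a * fser a z"
    unfolding fser_def by (intro suminf_mult summable_fser[OF a z(2)])
  finally show ?thesis
    by (simp add: z_def)
qed

section \<open>The primitive and its behaviour at 0\<close>

text \<open>For real \<open>w\<close> strictly between 0 and \<open>pi / 2\<close> this is
  \<open>sin (2 * w) * Phi w a\<close>. The complex argument allows complex differentiation before
  restricting to the real line.\<close>

definition prim :: "complex \<Rightarrow> complex \<Rightarrow> complex" where
  "prim a w = sin (2 * w) * (4 * sin w ^ 2) powr a * fser a (4 * sin w ^ 2)"

lemma has_vector_derivative_prim: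
  assumes \<theta>: "0 < \<theta>" "\<theta> < pi / 2" and a: "Re a > - 1 / 2"
  shows "((\<lambda>\<theta>. prim a (of_real \<theta>)) has_vector_derivative
            (2 + 4 * a) * f (1 + a) * complex_of_real (2 * sin \<theta>) powr (2 * a)) (at \<theta>)"
proof -
  define w where "w = complex_of_real \<theta>"
  define z where "z = 4 * sin w ^ 2"
  have zlam: "z = of_real (lam \<theta>)"
    by (simp add: z_def w_def lam_def sin_of_real)
  have z: "z \<noteq> 0" "norm z < 4" "z \<notin> \<real>\<^sub>\<le>\<^sub>0"
    using lam_bounds[OF \<theta>] by (auto simp: zlam)
  have dz: "((\<lambda>w. 4 * sin w ^ 2) has_field_derivative 4 * sin (2 * w)) (at w)"
    by (auto intro!: derivative_eq_intros simp: sin_double)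
  have dp: "((\<lambda>w. (4 * sin w ^ 2) powr a) has_field_derivative (a * z powr (a - 1)) * (4 * sin (2 * w))) (at w)"
    using DERIV_chain2[OF has_field_derivative_powr[OF z(3)[unfolded z_def]] dz] by (simp add: z_def)
  have ds: "((\<lambda>w. fser a (4 * sin w ^ 2)) has_field_derivative fser' a z * (4 * sin (2 * w))) (at w)"
    using DERIV_chain2[OF has_field_derivative_fser[OF a z(2)[unfolded z_def]] dz] by (simp add: z_def)
  have dsin: "((\<lambda>w. sin (2 * w)) has_field_derivative 2 * cos (2 * w)) (at w)"
    by (auto intro!: derivative_eq_intros)
  let ?D = "(2 * cos (2 * w) * z powr a + a * z powr (a - 1) * (4 * sin (2 * w)) * sin (2 * w)) * fser a z
              + fser' a z * (4 * sin (2 * w)) * (sin (2 * w) * z powr a)"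
  have D: "(prim a has_field_derivative ?D) (at w)"
    unfolding prim_def[abs_def] using DERIV_mult[OF DERIV_mult[OF dsin dp] ds] by (simp add: z_def)
  \<comment> \<open>These two identities express the trigonometric factors of \<open>?D\<close>
    through \<open>z\<close>. Then \<open>?D\<close> is \<open>z powr a\<close> times the left side
    of \<open>fser_ode\<close>.\<close>
  have s2: "4 * sin (2 * w) ^ 2 = z * (4 - z)"
    unfolding z_def sin_double power_mult_distrib cos_squared_eq
    by (simp add: algebra_simps power2_eq_square)
  have c2: "2 * cos (2 * w) = 2 - z"
    unfolding z_def cos_double_sin by (simp add: algebra_simps)
  have p: "z powr (a - 1) = z powr a / z"
    using z by (simp add: powr_diff)
  have "?D = z powr a * ((2 * cos (2 * w) + a * (4 * sin (2 * w) ^ 2) / z) * fser a z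
              + (4 * sin (2 * w) ^ 2) * fser' a z)"
    unfolding p by (simp add: algebra_simps power2_eq_square)
  also have "\<dots> = z powr a * (z * (4 - z) * fser' a z + (2 + 4 * a - (1 + a) * z) * fser a z)"
    unfolding s2 c2 using z by (simp add: field_simps)
  also have "\<dots> = (2 + 4 * a) * f (1 + a) * complex_of_real (2 * sin \<theta>) powr (2 * a)"
    using fser_ode[OF a z(2)] lam_powr[OF \<theta>, of a] by (simp add: zlam)
  finally show ?thesis
    using has_vector_derivative_real_field[of "prim a"] D by (simp add: w_def)
qed

text \<open>For \<open>Re a < 0\<close> the power \<open>z powr a\<close> blows up at 0, but
  \<open>sin (2 * \<theta>)\<close> is at most the square root of \<open>z\<close>. The resulting
  exponent \<open>Re a + 1 / 2\<close> is positive, and \<open>fser a\<close> is continuous at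
  0.\<close>

lemma tendsto_prim_0:
  assumes a: "Re a > - 1 / 2"
  shows "((\<lambda>\<theta>. prim a (of_real \<theta>)) \<longlongrightarrow> 0) (at_right 0)"
proof (rule Lim_null_comparison)
  have lam0: "(lam \<longlongrightarrow> 0) (at_right 0)"
    unfolding lam_def[abs_def] by (auto intro!: tendsto_eq_intros)
  have "isCont (fser a) 0"
    using has_field_derivative_fser[OF a, of 0] by (auto intro: DERIV_isCont)
  moreover have "((\<lambda>\<theta>. complex_of_real (lam \<theta>)) \<longlongrightarrow> 0) (at_right 0)"
    using tendsto_of_real[OF lam0, where 'a = complex] by simp
  ultimately have S: "((\<lambda>\<theta>. norm (fser a (of_real (lam \<theta>)))) \<longlongrightarrow> norm (fser a 0)) (at_right 0)"
    by (rule tendsto_norm[OF isCont_tendsto_compose])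
  have "((\<lambda>\<theta>. lam \<theta> powr (Re a + 1 / 2)) \<longlongrightarrow> 0) (at_right 0)"
    using a by (intro tendsto_zero_powrI[OF lam0 tendsto_const]) (auto simp: lam_def)
  from tendsto_mult[OF this S]
  show "((\<lambda>\<theta>. lam \<theta> powr (Re a + 1 / 2) * norm (fser a (of_real (lam \<theta>)))) \<longlongrightarrow> 0) (at_right 0)"
    by simp
  have "eventually (\<lambda>\<theta>. \<theta> \<in> {0<..<pi / 2}) (at_right (0::real))"
    by (rule eventually_at_right_real) auto
  thus "eventually (\<lambda>\<theta>. norm (prim a (of_real \<theta>))
          \<le> lam \<theta> powr (Re a + 1 / 2) * norm (fser a (of_real (lam \<theta>)))) (at_right 0)"
  proof eventually_elim
    case (elim \<theta>)
    hence pos: "0 < lam \<theta>" and s: "0 < sin \<theta>" "0 < cos \<theta>"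
      using lam_bounds[of \<theta>] by (auto intro!: sin_gt_zero cos_gt_zero)
    have "lam \<theta> powr (1 / 2) = 2 * sin \<theta>"
      using pos s by (simp add: powr_half_sqrt lam_def real_sqrt_mult)
    moreover have "\<bar>sin (2 * \<theta>)\<bar> \<le> 2 * sin \<theta>"
      using s by (simp add: sin_double abs_mult)
    ultimately have sin: "\<bar>sin (2 * \<theta>)\<bar> \<le> lam \<theta> powr (1 / 2)"
      by simp
    have "norm (sin (2 * complex_of_real \<theta>)) = \<bar>sin (2 * \<theta>)\<bar>"
      by (metis norm_of_real of_real_mult of_real_numeral sin_of_real)
    moreover have "4 * sin (complex_of_real \<theta>) ^ 2 = of_real (lam \<theta>)"
      by (simp add: lam_def sin_of_real)
    moreover have "norm (complex_of_real (lam \<theta>) powr a) = lam \<theta> powr Re a"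
      using pos by (simp add: norm_powr_real_powr)
    ultimately have "norm (prim a (of_real \<theta>))
        = \<bar>sin (2 * \<theta>)\<bar> * lam \<theta> powr Re a * norm (fser a (of_real (lam \<theta>)))"
      by (simp add: prim_def norm_mult)
    also have "\<dots> \<le> lam \<theta> powr (1 / 2) * lam \<theta> powr Re a * norm (fser a (of_real (lam \<theta>)))"
      by (intro mult_right_mono sin) auto
    finally show ?case
      by (simp add: powr_add mult_ac)
  qed
qed

theorem proposition2p2:
  fixes \<alpha> :: real and a :: complex
  assumes "0 < \<alpha>" and "\<alpha> < pi / 2" and "Re a > - 1 / 2"
  shows "Phi \<alpha> a =
    1 / complex_of_real (sin (2 * \<alpha>)) * (Gamma (1 + a) ^ 2 / Gamma (1 + 2 * a)) *
    integral {0..\<alpha>} (\<lambda>\<theta>. complex_of_real (2 * sin \<theta>) powr (2 * a))"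
proof -
  define P where "P = (\<lambda>\<theta>. prim a (complex_of_real \<theta>))"
  define C where "C = (2 + 4 * a) * f (1 + a)"
  define g where "g = (\<lambda>\<theta>. complex_of_real (2 * sin \<theta>) powr (2 * a))"
  have der: "(P has_vector_derivative C * g \<theta>) (at \<theta>)" if "0 < \<theta>" "\<theta> < pi / 2" for \<theta>
    using has_vector_derivative_prim[OF that assms(3)] by (simp add: P_def C_def g_def)
  have P0: "P 0 = 0"
    by (simp add: P_def prim_def)
  have "continuous_on {0..\<alpha>} P"
    unfolding continuous_on_eq_continuous_within
  proof
    fix \<theta> assume \<theta>: "\<theta> \<in> {0..\<alpha>}"
    show "continuous (at \<theta> within {0..\<alpha>}) P"
    proof (cases "\<theta> = 0")
      case True
      \<comment> \<open>Only the endpoint 0 needs the limit computed above; every other point of the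
        interval lies below \<open>pi / 2\<close>, where \<open>P\<close> is differentiable.\<close>
      have "continuous (at_right 0) P"
        using tendsto_prim_0[OF assms(3)] P0 by (simp add: continuous_within P_def)
      thus ?thesis
        using True assms(1) by (simp add: continuous_within at_within_Icc_at_right)
    next
      case False
      hence "(P has_vector_derivative C * g \<theta>) (at \<theta>)"
        using \<theta> assms by (intro der) auto
      thus ?thesis
        using has_vector_derivative_continuous continuous_at_imp_continuous_at_within by blast
    qed
  qed
  \<comment> \<open>The interior form of the fundamental theorem asks for the derivative only on the
    open interval. It yields integrability too, although \<open>g\<close> is unbounded near 0 when
    \<open>Re a < 0\<close>.\<close>
  hence "((\<lambda>\<theta>. C * g \<theta>) has_integral (P \<alpha> - P 0)) {0..\<alpha>}"
    using assms der by (intro fundamental_theorem_of_calculus_interior) auto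
  from integral_unique[OF this] have int: "P \<alpha> = C * integral {0..\<alpha>} g"
    by (simp add: P0)
  define d where "d = 1 + 2 * a"
  have d: "d \<noteq> 0" "d \<notin> \<int>\<^sub>\<le>\<^sub>0"
    using assms(3) by (auto intro!: Re_pos_notin_nonpos_Ints simp: d_def complex_eq_iff)
  \<comment> \<open>The denominator of \<open>f (1 + a)\<close> is
    \<open>2 * Gamma (d + 1) = 2 * d * Gamma d\<close>, and its factor \<open>2 * d\<close> cancels
    against \<open>2 + 4 * a\<close>.\<close>
  have "2 + 4 * a = 2 * d" "2 * (1 + a) = d + 1"
    by (simp_all add: d_def)
  hence "C = Gamma (1 + a) ^ 2 / Gamma d"
    unfolding C_def f_def using d by (simp only: Gamma_plus1[OF d(2)]) simp
  hence C: "C = Gamma (1 + a) ^ 2 / Gamma (1 + 2 * a)"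
    by (simp add: d_def)
  have "sin (2 * \<alpha>) \<noteq> 0"
    using assms sin_gt_zero[of "2 * \<alpha>"] by simp
  moreover have "P \<alpha> = of_real (sin (2 * \<alpha>)) * Phi \<alpha> a"
    using Phi_eq_fser[OF assms] by (simp add: P_def prim_def lam_def sin_of_real[symmetric] mult_ac)
  ultimately have "Phi \<alpha> a = 1 / of_real (sin (2 * \<alpha>)) * P \<alpha>"
    by simp
  thus ?thesis
    unfolding int C g_def by simp
qed

end
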